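(* Let $\alpha\in(0,1)$ and $0<\zeta<1-\alpha$. There exists a constant $b=b(\alpha,\zeta)>0$, independent of the dimension $d$ (and of $m,n$), such that with $\epsilon_{m,n}=b\,(m^{-1/2}+n^{-1/2})$ the minimax type II error satisfies $$1-\beta_{m,n}(\epsilon_{m,n})=\inf_{\phi\in\mathbb{T}_{m,n}(\alpha)}\ \sup_{(P_X,P_Y)\in\mathcal F(\epsilon_{m,n})}\mathbb{P}_1(\phi=0)\ \ge\ \zeta .$$
   Context: Data: $\mathcal X_m=\{X_1,\dots,X_m\}$ i.i.d. from $P_X$ and, independently, $\mathcal Y_n=\{Y_1,\dots,Y_n\}$ i.i.d. from $P_Y$ on $\mathbb{R}^d$, $m,n\ge2$. All pairs considered satisfy the standing assumption that $\beta^\top X$ and $\beta^\top Y$ ($X\sim P_X$, $Y\sim P_Y$) have continuous distribution functions for $\lambda$-almost all $\beta\in\mathbb{S}^{d-1}$, $\lambda$ being the uniform probability measure on the unit sphere. CvM-distance: $W_d\ge0$ with $$W_d^2(P_X,P_Y)=\int_{\mathbb{S}^{d-1}}\int_{\mathbb{R}}\big(F_{\beta^\top X}(t)-F_{\beta^\top Y}(t)\big)^2\,d\{\vartheta_XF_{\beta^\top X}(t)+\vartheta_YF_{\beta^\top Y}(t)\}\,d\lambda(\beta),$$ $F_{\beta^\top X}$ the distribution function of $\beta^\top X$, $\vartheta_X\in(0,1)$ fixed, $\vartheta_Y=1-\vartheta_X$ (the value does not depend on $\vartheta_X$ under the continuity assumption). $\mathcal F(\epsilon)=\{(P_X,P_Y):W_d(P_X,P_Y)\ge\epsilon\}$.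 $\mathbb{T}_{m,n}(\alpha)$ is the set of measurable $\{0,1\}$-valued functions $\phi$ of $(\mathcal X_m,\mathcal Y_n)$ with $\mathbb{P}_0(\phi=1)\le\alpha$ under the null hypothesis $P_X=P_Y$; $\mathbb{P}_1$ is the probability when the data come from $(P_X,P_Y)\in\mathcal F(\epsilon)$. *)

theory Defs
  imports "HOL-Probability.Probability"
begin

text \<open>
  The dimension \<open>d\<close> is quantified inside the theorem, after the constant, so it cannot be a type:
  \<open>\<real>\<^sup>d\<close> is the product space over the index set \<open>{..<d}\<close>, carrying Lebesgue measure.
\<close>

definition Rd :: "nat \<Rightarrow> (nat \<Rightarrow> real) measure" where
  "Rd d = PiM {..<d} (\<lambda>_. lborel)"

definition ip :: "nat \<Rightarrow> (nat \<Rightarrow> real) \<Rightarrow> (nat \<Rightarrow> real) \<Rightarrow> real" where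
  "ip d x y = (\<Sum>i<d. x i * y i)"

definition unit_sphere :: "nat \<Rightarrow> (nat \<Rightarrow> real) set" where
  "unit_sphere d = {x \<in> space (Rd d). L2_set x {..<d} = 1}"

definition unit_ball :: "nat \<Rightarrow> (nat \<Rightarrow> real) set" where
  "unit_ball d = {x \<in> space (Rd d). L2_set x {..<d} \<le> 1}"

text \<open>
  The uniform probability measure on the sphere, obtained as the law of the direction \<open>x / |x|\<close> of a
  point \<open>x\<close> uniformly distributed in the unit ball. It is a Borel measure on \<open>\<real>\<^sup>d\<close> concentrated
  on \<open>unit_sphere d\<close> (see \<open>AE_sphere_measure\<close>), so integrals over the sphere are integrals
  with respect to it. For \<open>d = 1\<close> it gives mass 1/2 to each of \<open>1\<close> and \<open>-1\<close>.
\<close>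

definition sphere_measure :: "nat \<Rightarrow> (nat \<Rightarrow> real) measure" where
  "sphere_measure d =
     distr (uniform_measure (Rd d) (unit_ball d)) (Rd d)
       (\<lambda>x. \<lambda>i\<in>{..<d}. x i / L2_set x {..<d})"

definition prob_measures :: "nat \<Rightarrow> (nat \<Rightarrow> real) measure set" where
  "prob_measures d = {P. prob_space P \<and> sets P = sets (Rd d)}"

definition proj_cdf :: "nat \<Rightarrow> (nat \<Rightarrow> real) measure \<Rightarrow> (nat \<Rightarrow> real) \<Rightarrow> real \<Rightarrow> real" where
  "proj_cdf d P \<beta> = cdf (distr P borel (ip d \<beta>))"

definition cont_projections :: "nat \<Rightarrow> (nat \<Rightarrow> real) measure \<Rightarrow> bool" where
  "cont_projections d P \<longleftrightarrow>
     (AE \<beta> in sphere_measure d. continuous_on UNIV (proj_cdf d P \<beta>))"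

text \<open>
  \<open>\<theta>\<close> is the weight of \<open>P\<^sub>X\<close>; the inner integral is the Lebesgue-Stieltjes integral with respect to
  the mixture of the two distribution functions.
\<close>

definition CvM_sq ::
  "nat \<Rightarrow> real \<Rightarrow> (nat \<Rightarrow> real) measure \<Rightarrow> (nat \<Rightarrow> real) measure \<Rightarrow> real" where
  "CvM_sq d \<theta> P Q =
     (LINT \<beta>|sphere_measure d.
        (LINT t|interval_measure (\<lambda>t. \<theta> * proj_cdf d P \<beta> t + (1 - \<theta>) * proj_cdf d Q \<beta> t).
           (proj_cdf d P \<beta> t - proj_cdf d Q \<beta> t)\<^sup>2))"

definition CvM_dist ::
  "nat \<Rightarrow> real \<Rightarrow> (nat \<Rightarrow> real) measure \<Rightarrow> (nat \<Rightarrow> real) measure \<Rightarrow> real" where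
  "CvM_dist d \<theta> P Q = sqrt (CvM_sq d \<theta> P Q)"

definition alternatives ::
  "nat \<Rightarrow> real \<Rightarrow> real \<Rightarrow> ((nat \<Rightarrow> real) measure \<times> (nat \<Rightarrow> real) measure) set" where
  "alternatives d \<theta> \<epsilon> =
     {(P, Q). P \<in> prob_measures d \<and> Q \<in> prob_measures d \<and>
        cont_projections d P \<and> cont_projections d Q \<and> CvM_dist d \<theta> P Q \<ge> \<epsilon>}"

text \<open>Joint law of two independent i.i.d. samples, of size \<open>m\<close> from \<open>P\<close> and of size \<open>n\<close> from \<open>Q\<close>.\<close>

definition sample_law ::
  "nat \<Rightarrow> nat \<Rightarrow> (nat \<Rightarrow> real) measure \<Rightarrow> (nat \<Rightarrow> real) measure \<Rightarrow>
     ((nat \<Rightarrow> nat \<Rightarrow> real) \<times> (nat \<Rightarrow> nat \<Rightarrow> real)) measure" where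
  "sample_law m n P Q = PiM {..<m} (\<lambda>_. P) \<Otimes>\<^sub>M PiM {..<n} (\<lambda>_. Q)"

definition level_tests ::
  "nat \<Rightarrow> nat \<Rightarrow> nat \<Rightarrow> real \<Rightarrow>
     ((nat \<Rightarrow> nat \<Rightarrow> real) \<times> (nat \<Rightarrow> nat \<Rightarrow> real) \<Rightarrow> nat) set" where
  "level_tests d m n \<alpha> =
     {\<phi> \<in> measurable (PiM {..<m} (\<lambda>_. Rd d) \<Otimes>\<^sub>M PiM {..<n} (\<lambda>_. Rd d)) (count_space {0, 1}).
        \<forall>P \<in> prob_measures d. cont_projections d P \<longrightarrow>
          measure (sample_law m n P P) {\<omega> \<in> space (sample_law m n P P). \<phi> \<omega> = 1} \<le> \<alpha>}"

text \<open>
  Stated in \<open>ennreal\<close>, where a supremum over an empty class of alternatives is 0 (over the reals it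
  would be unspecified).
\<close>

definition minimax_type2_error ::
  "nat \<Rightarrow> real \<Rightarrow> nat \<Rightarrow> nat \<Rightarrow> real \<Rightarrow> real \<Rightarrow> ennreal" where
  "minimax_type2_error d \<theta> m n \<alpha> \<epsilon> =
     (INF \<phi> \<in> level_tests d m n \<alpha>. SUP (P, Q) \<in> alternatives d \<theta> \<epsilon>.
        emeasure (sample_law m n P Q) {\<omega> \<in> space (sample_law m n P Q). \<phi> \<omega> = 0})"

lemma space_Rd: "space (Rd d) = {..<d} \<rightarrow>\<^sub>E UNIV"
  by (simp add: Rd_def space_PiM)

lemma L2_measurable [measurable]: "(\<lambda>x. L2_set x {..<d}) \<in> borel_measurable (Rd d)"
  unfolding L2_set_def Rd_def by measurable

lemma unit_ball_sets [measurable]: "unit_ball d \<in> sets (Rd d)"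
  unfolding unit_ball_def by measurable

lemma unit_sphere_sets [measurable]: "unit_sphere d \<in> sets (Rd d)"
  unfolding unit_sphere_def by measurable

lemma direction_measurable [measurable]:
  "(\<lambda>x. \<lambda>i\<in>{..<d}. x i / L2_set x {..<d}) \<in> measurable (Rd d) (Rd d)"
proof -
  have *: "(\<lambda>x. L2_set x {..<d}) \<in> borel_measurable (PiM {..<d} (\<lambda>_. lborel))"
    using L2_measurable by (simp add: Rd_def)
  show ?thesis
    unfolding Rd_def using * by measurable
qed

lemma emeasure_Rd_box:
  "emeasure (Rd d) ({..<d} \<rightarrow>\<^sub>E {- r..r}) = (\<Prod>i<d. emeasure lborel {- r..r::real})"
proof -
  interpret product_sigma_finite "\<lambda>_::nat. lborel :: real measure" ..
  show ?thesis
    unfolding Rd_def by (rule emeasure_PiM) auto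
qed

lemma emeasure_unit_ball_finite: "emeasure (Rd d) (unit_ball d) \<noteq> \<infinity>"
proof -
  have "unit_ball d \<subseteq> ({..<d} \<rightarrow>\<^sub>E {- 1..1})"
  proof
    fix x assume x: "x \<in> unit_ball d"
    have "\<bar>x i\<bar> \<le> 1" if "i < d" for i
    proof -
      have "\<bar>x i\<bar> \<le> L2_set (\<lambda>i. \<bar>x i\<bar>) {..<d}"
        using that by (intro member_le_L2_set) auto
      also have "\<dots> = L2_set x {..<d}"
        by (simp add: L2_set_def)
      finally show ?thesis using x by (simp add: unit_ball_def)
    qed
    then show "x \<in> {..<d} \<rightarrow>\<^sub>E {- 1..1}"
      using x by (auto simp: unit_ball_def space_Rd PiE_iff abs_le_iff minus_le_iff)
  qed
  then have "emeasure (Rd d) (unit_ball d) \<le> emeasure (Rd d) ({..<d} \<rightarrow>\<^sub>E {- 1..1})"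
    by (intro emeasure_mono) (auto simp: Rd_def intro!: sets_PiM_I_finite)
  also have "\<dots> < \<infinity>"
    proof -
    have "(2::ennreal) ^ d = ennreal (2 ^ d)"
      by (simp flip: ennreal_power)
    then show ?thesis
      unfolding emeasure_Rd_box by simp
  qed
  finally show ?thesis by simp
qed

lemma emeasure_unit_ball_pos:
  assumes "d \<ge> 1"
  shows "emeasure (Rd d) (unit_ball d) \<noteq> 0"
proof -
  define r where "r = 1 / real d"
  have r: "r > 0" using assms by (simp add: r_def)
  have "({..<d} \<rightarrow>\<^sub>E {- r..r}) \<subseteq> unit_ball d"
  proof
    fix x assume x: "x \<in> {..<d} \<rightarrow>\<^sub>E {- r..r}"
    have "L2_set x {..<d} \<le> (\<Sum>i<d. \<bar>x i\<bar>)"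
      by (rule L2_set_le_sum_abs)
    also have "\<dots> \<le> (\<Sum>i<d. r)"
      using x by (intro sum_mono) (auto simp: PiE_iff abs_le_iff minus_le_iff)
    also have "\<dots> = 1" using assms by (simp add: r_def)
    finally show "x \<in> unit_ball d"
      using x by (auto simp: unit_ball_def space_Rd PiE_iff)
  qed
  then have "emeasure (Rd d) ({..<d} \<rightarrow>\<^sub>E {- r..r}) \<le> emeasure (Rd d) (unit_ball d)"
    by (intro emeasure_mono) auto
  moreover have "emeasure (Rd d) ({..<d} \<rightarrow>\<^sub>E {- r..r}) \<noteq> 0"
    unfolding emeasure_Rd_box using r by auto
  ultimately show ?thesis by auto
qed

lemma prob_space_sphere_measure:
  assumes "d \<ge> 1"
  shows "prob_space (sphere_measure d)"
  unfolding sphere_measure_def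
  using emeasure_unit_ball_pos[OF assms] emeasure_unit_ball_finite
  by (intro prob_space.prob_space_distr prob_space_uniform_measure)
     (auto simp: measurable_cong_sets[OF sets_uniform_measure refl])

lemma AE_sphere_measure:
  assumes "d \<ge> 1"
  shows "AE \<beta> in sphere_measure d. \<beta> \<in> unit_sphere d"
proof -
  let ?f = "\<lambda>x. \<lambda>i\<in>{..<d}. x i / L2_set x {..<d}"
  let ?z = "\<lambda>i\<in>{..<d}. 0 :: real"
  have sphere: "?f x \<in> unit_sphere d" if x: "x \<in> space (Rd d)" "x \<noteq> ?z" for x
  proof -
    have "\<exists>i<d. x i \<noteq> 0"
    proof (rule ccontr)
      assume "\<not> (\<exists>i<d. x i \<noteq> 0)"
      then have "x = ?z"
        using x(1) by (auto simp: space_Rd PiE_iff extensional_def fun_eq_iff)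
      with x(2) show False ..
    qed
    then have "L2_set x {..<d} \<noteq> 0"
      by (auto simp: L2_set_eq_0_iff)
    then have pos: "L2_set x {..<d} > 0"
      using L2_set_nonneg[of x "{..<d}"] by linarith
    have "L2_set (?f x) {..<d} = L2_set (\<lambda>i. inverse (L2_set x {..<d}) * x i) {..<d}"
      by (rule L2_set_cong) (auto simp: field_simps)
    also have "\<dots> = inverse (L2_set x {..<d}) * L2_set x {..<d}"
      using pos by (intro L2_set_right_distrib[symmetric]) auto
    finally show ?thesis using pos by (auto simp: unit_sphere_def space_Rd)
  qed
  have z: "emeasure (Rd d) {?z} = 0"
  proof -
    have "{?z} = ({..<d} \<rightarrow>\<^sub>E {- 0..0})"
      by (auto simp: PiE_iff extensional_def fun_eq_iff)
    moreover have "emeasure (Rd d) ({..<d} \<rightarrow>\<^sub>E {- 0..0}) = 0"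
      unfolding emeasure_Rd_box using assms by simp
    ultimately show ?thesis by simp
  qed
  have zs: "{?z} \<in> sets (Rd d)"
  proof -
    have "{?z} = (\<Pi>\<^sub>E i\<in>{..<d}. {0})"
      by (auto simp: PiE_iff extensional_def fun_eq_iff)
    moreover have "(\<Pi>\<^sub>E i\<in>{..<d}. {0}) \<in> sets (Rd d)"
      unfolding Rd_def by (rule sets_PiM_I_finite) auto
    ultimately show ?thesis by simp
  qed
  have "AE x in Rd d. x \<notin> {?z}"
    using z zs by (intro AE_not_in) auto
  then have "AE x in Rd d. x \<in> unit_ball d \<longrightarrow> ?f x \<in> unit_sphere d"
    by (rule AE_mp) (auto intro!: AE_I2 sphere)
  then have "AE x in uniform_measure (Rd d) (unit_ball d). ?f x \<in> unit_sphere d"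
    by (intro AE_uniform_measureI) auto
  then show ?thesis
    unfolding sphere_measure_def
    by (subst AE_distr_iff) (auto simp: measurable_cong_sets[OF sets_uniform_measure refl])
qed

end

theory Submission
  imports Defs
begin

text \<open>
  Le Cam's two-point method with laws carried by a line, which makes everything independent of \<open>d\<close>:
  under the null both samples are uniform on the segment from 0 to the first unit vector, under the
  alternative the smaller sample has the density \<open>1 + \<delta>\<close> on the first third, \<open>1 - \<delta>\<close> on the last
  third and 1 in between, where \<open>\<delta>\<^sup>2\<close> is a small multiple of \<open>1 / min m n\<close>. In almost every direction
  the projected distribution functions differ by exactly \<open>\<delta> / 3\<close> on the middle third, so
  \<open>W\<^sub>d\<^sup>2 \<ge> \<delta>\<^sup>2 / 27\<close>, while the \<open>\<chi>\<^sup>2\<close>-divergence of the samples is at most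
  \<open>(1 + \<delta>\<^sup>2) ^ min m n - 1\<close>, which stays below any prescribed level.
\<close>

section \<open>Likelihood ratios of product measures\<close>

text \<open>A product law is determined by its values on boxes. There the indicator splits into one
  factor per coordinate, as the density does, and the integral becomes a product of integrals over
  \<open>M\<close>.\<close>

lemma (in prob_space) PiM_density_prod:
  fixes q :: "'a \<Rightarrow> real"
  assumes [measurable]: "q \<in> borel_measurable M" and q: "\<And>x. 0 \<le> q x"
    and Q: "prob_space (density M q)" and I: "finite I"
  shows "PiM I (\<lambda>_. density M q) = density (PiM I (\<lambda>_. M)) (\<lambda>x. \<Prod>i\<in>I. q (x i))"
proof -
  interpret Q: prob_space "density M q" by fact
  interpret P: product_sigma_finite "\<lambda>_. M" ..
  interpret Q: product_sigma_finite "\<lambda>_. density M q" ..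
  show ?thesis
  proof (rule Q.PiM_eqI[symmetric])
    show "finite I" by fact
    show "sets (density (PiM I (\<lambda>_. M)) (\<lambda>x. \<Prod>i\<in>I. q (x i))) = sets (PiM I (\<lambda>_. density M q))"
      by (auto intro!: sets_PiM_cong)
    fix A assume A: "\<And>i. i \<in> I \<Longrightarrow> A i \<in> sets (density M q)"
    then have [measurable]: "i \<in> I \<Longrightarrow> A i \<in> sets M" for i by simp
    have [measurable]: "Pi\<^sub>E I A \<in> sets (PiM I (\<lambda>_. M))"
      using I by (intro sets_PiM_I_finite) auto
    have "emeasure (density (PiM I (\<lambda>_. M)) (\<lambda>x. \<Prod>i\<in>I. q (x i))) (Pi\<^sub>E I A) =
        (\<integral>\<^sup>+x. ennreal (\<Prod>i\<in>I. q (x i)) * indicator (Pi\<^sub>E I A) x \<partial>PiM I (\<lambda>_. M))"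
      by (rule emeasure_density) (use I in measurable)
    also have "\<dots> = (\<integral>\<^sup>+x. (\<Prod>i\<in>I. ennreal (q (x i)) * indicator (A i) (x i)) \<partial>PiM I (\<lambda>_. M))"
    proof (rule nn_integral_cong)
      fix x assume x: "x \<in> space (PiM I (\<lambda>_. M))"
      have "(indicator (Pi\<^sub>E I A) x :: ennreal) = (\<Prod>i\<in>I. indicator (A i) (x i))"
      proof (cases "x \<in> Pi\<^sub>E I A")
        case False
        then obtain i where "i \<in> I" "x i \<notin> A i"
          using x by (auto simp: space_PiM PiE_iff)
        with I have "(\<Prod>i\<in>I. indicator (A i) (x i) :: ennreal) = 0"
          by (intro prod_zero bexI[of _ i]) auto
        then show ?thesis using False by simp
      qed (auto simp: PiE_iff)
      then show "ennreal (\<Prod>i\<in>I. q (x i)) * indicator (Pi\<^sub>E I A) x =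
          (\<Prod>i\<in>I. ennreal (q (x i)) * indicator (A i) (x i))"
        using q by (simp add: prod.distrib prod_ennreal)
    qed
    also have "\<dots> = (\<Prod>i\<in>I. \<integral>\<^sup>+x. ennreal (q x) * indicator (A i) x \<partial>M)"
      using I by (intro P.product_nn_integral_prod) auto
    also have "\<dots> = (\<Prod>i\<in>I. emeasure (density M q) (A i))"
      by (intro prod.cong) (auto simp: emeasure_density)
    finally show "emeasure (density (PiM I (\<lambda>_. M)) (\<lambda>x. \<Prod>i\<in>I. q (x i))) (Pi\<^sub>E I A) =
        (\<Prod>i\<in>I. emeasure (density M q) (A i))" .
  qed
qed

text \<open>The gap between the two sides is the variance.\<close>

lemma (in prob_space) square_expectation_le:
  fixes f :: "'a \<Rightarrow> real"
  assumes "integrable M f" "integrable M (\<lambda>x. (f x)\<^sup>2)"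
  shows "(expectation f)\<^sup>2 \<le> expectation (\<lambda>x. (f x)\<^sup>2)"
  using variance_eq[OF assms] variance_positive[of f] by simp

text \<open>The second moment of the likelihood ratio factorises, and Cauchy--Schwarz bounds the change
  in the probability of an event by the standard deviation of the ratio.\<close>

lemma (in prob_space) measure_PiM_density_le:
  fixes q :: "'a \<Rightarrow> real"
  assumes [measurable]: "q \<in> borel_measurable M" and q: "\<And>x. 0 \<le> q x"
    and Q: "prob_space (density M q)"
    and int: "integrable M (\<lambda>x. (q x)\<^sup>2)" and s: "expectation (\<lambda>x. (q x)\<^sup>2) \<le> 1 + s"
    and I: "finite I" and B: "B \<in> sets (PiM I (\<lambda>_. M))"
  shows "measure (PiM I (\<lambda>_. density M q)) B \<le>
    measure (PiM I (\<lambda>_. M)) B + sqrt ((1 + s) ^ card I - 1)"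
proof -
  let ?N = "PiM I (\<lambda>_. M)"
  let ?L = "\<lambda>x. \<Prod>i\<in>I. q (x i)"
  note B [measurable]
  interpret P: product_sigma_finite "\<lambda>_. M" ..
  interpret Q: prob_space "density M q" by fact
  interpret N: prob_space ?N by (rule prob_space_PiM) unfold_locales
  interpret QN: prob_space "PiM I (\<lambda>_. density M q)"
    by (rule prob_space_PiM) unfold_locales
  have Lm [measurable]: "?L \<in> borel_measurable ?N"
    using I by measurable
  have L0: "0 \<le> ?L x" for x
    using q by (intro prod_nonneg) auto
  have eq: "PiM I (\<lambda>_. density M q) = density ?N ?L"
    by (rule PiM_density_prod) fact+
  have L2: "integrable ?N (\<lambda>x. (?L x)\<^sup>2)"
    unfolding prod_power_distrib using I int by (intro P.product_integrable_prod) auto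
  have L1: "integrable ?N ?L"
    by (rule N.square_integrable_imp_integrable[OF _ L2]) simp
  \<comment> \<open>The mean of the likelihood ratio is the total mass of the product of the
    perturbed laws.\<close>
  have "(\<integral>\<^sup>+x. ennreal (?L x) \<partial>?N) = 1"
    using QN.emeasure_space_1 unfolding eq by (simp add: emeasure_density cong: nn_integral_cong)
  then have EL: "N.expectation ?L = 1"
    using L0 by (simp add: integral_eq_nn_integral)
  have "N.expectation (\<lambda>x. (?L x)\<^sup>2) = (\<Prod>i\<in>I. expectation (\<lambda>x. (q x)\<^sup>2))"
    unfolding prod_power_distrib using I int by (intro P.product_integral_prod) auto
  also have "\<dots> \<le> (1 + s) ^ card I"
    using s by (auto intro!: power_mono)
  finally have EL2: "N.expectation (\<lambda>x. (?L x)\<^sup>2) \<le> (1 + s) ^ card I" .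
  \<comment> \<open>The integral of \<open>?f\<close> is the difference of the two probabilities of
    \<open>B\<close>. Its square is at most the second moment of \<open>?f\<close>, and dropping the
    indicator only enlarges that.\<close>
  let ?f = "\<lambda>x. (?L x - 1) * indicator B x"
  have L12: "integrable ?N (\<lambda>x. (?L x - 1)\<^sup>2)"
    using L1 L2 by (simp add: power2_diff)
  have f1: "integrable ?N ?f"
    using L1 by (intro integrable_real_mult_indicator) auto
  have f2eq: "(?f x)\<^sup>2 = (?L x - 1)\<^sup>2 * indicator B x" for x
    by (auto split: split_indicator)
  have f2: "integrable ?N (\<lambda>x. (?f x)\<^sup>2)"
    unfolding f2eq using L12 by (intro integrable_real_mult_indicator) auto
  have "(N.expectation ?f)\<^sup>2 \<le> N.expectation (\<lambda>x. (?f x)\<^sup>2)"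
    by (rule N.square_expectation_le[OF f1 f2])
  also have "\<dots> \<le> N.expectation (\<lambda>x. (?L x - 1)\<^sup>2)"
    by (intro integral_mono f2 L12) (auto split: split_indicator)
  \<comment> \<open>As \<open>?L\<close> has mean one, this is its variance, the chi-square
    divergence of the two product laws.\<close>
  also have "\<dots> = N.expectation (\<lambda>x. (?L x)\<^sup>2) - 1"
    using L1 L2 EL by (simp add: power2_diff N.prob_space)
  also have "\<dots> \<le> (1 + s) ^ card I - 1"
    using EL2 by simp
  finally have le: "N.expectation ?f \<le> sqrt ((1 + s) ^ card I - 1)"
    by (rule real_le_rsqrt)
  have iLB: "integrable ?N (\<lambda>x. ?L x * indicator B x)"
    using L1 by (intro integrable_real_mult_indicator) auto
  have "measure (PiM I (\<lambda>_. density M q)) B = N.expectation (\<lambda>x. ?L x * indicator B x)"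
  proof -
    have "emeasure (density ?N ?L) B = (\<integral>\<^sup>+x. ennreal (?L x * indicator B x) \<partial>?N)"
      by (subst emeasure_density) (auto intro!: nn_integral_cong split: split_indicator)
    also have "\<dots> = ennreal (N.expectation (\<lambda>x. ?L x * indicator B x))"
      using L0 by (intro nn_integral_eq_integral iLB) auto
    finally show ?thesis
      unfolding eq measure_def using L0 by (simp add: integral_nonneg)
  qed
  also have "\<dots> = N.expectation ?f + N.expectation (indicator B)"
    by (subst Bochner_Integration.integral_add[symmetric])
      (use f1 in \<open>auto simp: algebra_simps N.emeasure_eq_measure less_top[symmetric]
        intro!: integrable_real_indicator\<close>)
  also have "N.expectation (indicator B) = measure ?N B" by simp
  finally show ?thesis using le by simp
qed

section \<open>Replacing one factor of a product of two laws\<close>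

text \<open>Every section of \<open>A\<close> gains at most \<open>k\<close>, and integrating this
  over the common factor keeps the constant because \<open>M\<close> has mass one.\<close>

lemma measure_pair_le_snd:
  assumes "prob_space M" "prob_space N" "prob_space N'" and sets: "sets N' = sets N" and "0 \<le> k"
    and le: "\<And>B. B \<in> sets N \<Longrightarrow> measure N' B \<le> measure N B + k"
    and A: "A \<in> sets (M \<Otimes>\<^sub>M N)"
  shows "measure (M \<Otimes>\<^sub>M N') A \<le> measure (M \<Otimes>\<^sub>M N) A + k"
proof -
  interpret M: prob_space M by fact
  interpret N: prob_space N by fact
  interpret N': prob_space N' by fact
  interpret P: pair_prob_space M N ..
  interpret P': pair_prob_space M N' ..
  note sets [measurable_cong] and A [measurable]
  have A': "A \<in> sets (M \<Otimes>\<^sub>M N')" by simp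
  have "emeasure (M \<Otimes>\<^sub>M N') A = (\<integral>\<^sup>+x. emeasure N' (Pair x -` A) \<partial>M)"
    by (rule N'.emeasure_pair_measure_alt[OF A'])
  also have "\<dots> \<le> (\<integral>\<^sup>+x. emeasure N (Pair x -` A) + k \<partial>M)"
    using le[OF sets_Pair1[OF A]] \<open>0 \<le> k\<close>
    by (intro nn_integral_mono)
      (simp add: N.emeasure_eq_measure N'.emeasure_eq_measure flip: ennreal_plus)
  also have "\<dots> = (\<integral>\<^sup>+x. emeasure N (Pair x -` A) \<partial>M) + k"
    by (subst nn_integral_add) (auto simp: M.emeasure_space_1 N.measurable_emeasure_Pair)
  also have "\<dots> = emeasure (M \<Otimes>\<^sub>M N) A + k"
    by (simp add: N.emeasure_pair_measure_alt)
  finally show ?thesis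
    using \<open>0 \<le> k\<close> by (simp add: P.emeasure_eq_measure P'.emeasure_eq_measure flip: ennreal_plus)
qed

text \<open>The mirror image, with sections taken at a fixed second coordinate.\<close>

lemma measure_pair_le_fst:
  assumes "prob_space M" "prob_space M'" "prob_space N" and sets: "sets M' = sets M" and "0 \<le> k"
    and le: "\<And>B. B \<in> sets M \<Longrightarrow> measure M' B \<le> measure M B + k"
    and A: "A \<in> sets (M \<Otimes>\<^sub>M N)"
  shows "measure (M' \<Otimes>\<^sub>M N) A \<le> measure (M \<Otimes>\<^sub>M N) A + k"
proof -
  interpret M: prob_space M by fact
  interpret M': prob_space M' by fact
  interpret N: prob_space N by fact
  interpret P: pair_prob_space M N ..
  interpret P': pair_prob_space M' N ..
  interpret S: pair_prob_space N M ..
  note sets [measurable_cong] and A [measurable]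
  have A': "A \<in> sets (M' \<Otimes>\<^sub>M N)" by simp
  have "emeasure (M' \<Otimes>\<^sub>M N) A = (\<integral>\<^sup>+y. emeasure M' ((\<lambda>x. (x, y)) -` A) \<partial>N)"
    by (rule P'.emeasure_pair_measure_alt2[OF A'])
  also have "\<dots> \<le> (\<integral>\<^sup>+y. emeasure M ((\<lambda>x. (x, y)) -` A) + k \<partial>N)"
    using le[OF sets_Pair2[OF A]] \<open>0 \<le> k\<close>
    by (intro nn_integral_mono)
      (simp add: M.emeasure_eq_measure M'.emeasure_eq_measure flip: ennreal_plus)
  also have "\<dots> = (\<integral>\<^sup>+y. emeasure M ((\<lambda>x. (x, y)) -` A) \<partial>N) + k"
    by (subst nn_integral_add) (auto simp: N.emeasure_space_1 P.measurable_emeasure_Pair2)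
  also have "\<dots> = emeasure (M \<Otimes>\<^sub>M N) A + k"
    by (simp add: P.emeasure_pair_measure_alt2)
  finally show ?thesis
    using \<open>0 \<le> k\<close> by (simp add: P.emeasure_eq_measure P'.emeasure_eq_measure flip: ennreal_plus)
qed

section \<open>Distribution functions and generic directions\<close>

text \<open>A law on the line is determined by its distribution function. This turns the Stieltjes
  integral in \<open>CvM_sq\<close> into an integral against a known law.\<close>

lemma interval_measure_cdf:
  assumes "real_distribution M"
  shows "interval_measure (cdf M) = M"
proof -
  interpret M: real_distribution M by fact
  show ?thesis
    by (rule cdf_unique)
      (auto intro!: real_distribution_interval_measure cdf_interval_measure assms
        M.cdf_nondecreasing M.cdf_is_right_cont M.cdf_lim_at_bot M.cdf_lim_at_top_prob)
qed

lemma nth_measurable: "i < d \<Longrightarrow> (\<lambda>x. x i) \<in> borel_measurable (Rd d)"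
  unfolding Rd_def using measurable_component_singleton[of i "{..<d}" "\<lambda>_. lborel"] by simp

text \<open>A coordinate hyperplane is Lebesgue-null, and normalising a nonzero vector does not
  change which coordinates vanish. For \<open>k = 0\<close> this discards the directions in which a
  law on the first axis projects to a point mass.\<close>

lemma AE_sphere_measure_nth_ne_0:
  assumes "k < d"
  shows "AE \<beta> in sphere_measure d. \<beta> k \<noteq> 0"
proof -
  interpret product_sigma_finite "\<lambda>_::nat. lborel :: real measure" ..
  let ?f = "\<lambda>x. \<lambda>i\<in>{..<d}. x i / L2_set x {..<d}"
  let ?H = "\<Pi>\<^sub>E i\<in>{..<d}. if i = k then {0::real} else UNIV"
  have "?H \<in> null_sets (Rd d)"
  proof (rule null_setsI)
    have "emeasure (Rd d) ?H =
        (\<Prod>i<d. emeasure lborel (if i = k then {0::real} else UNIV))"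
      unfolding Rd_def by (rule emeasure_PiM) auto
    \<comment> \<open>The other factors are infinite, but in \<open>ennreal\<close> a single factor
      0 annihilates them.\<close>
    also have "\<dots> = 0" using assms by (auto intro!: bexI[of _ k])
    finally show "emeasure (Rd d) ?H = 0" .
    show "?H \<in> sets (Rd d)"
      unfolding Rd_def by (rule sets_PiM_I_finite) auto
  qed
  then have "AE x in Rd d. x \<notin> ?H" by (rule AE_not_in)
  then have "AE x in Rd d. x \<in> unit_ball d \<longrightarrow> ?f x k \<noteq> 0"
  proof (rule AE_mp, intro AE_I2 impI)
    fix x assume x: "x \<in> space (Rd d)" "x \<notin> ?H" "x \<in> unit_ball d"
    then have "x k \<noteq> 0" by (auto simp: space_Rd PiE_iff split: if_splits)
    moreover from this have "L2_set x {..<d} \<noteq> 0"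
      using assms by (auto simp: L2_set_eq_0_iff)
    ultimately show "?f x k \<noteq> 0" using assms by simp
  qed
  then have "AE x in uniform_measure (Rd d) (unit_ball d). ?f x k \<noteq> 0"
    by (intro AE_uniform_measureI) auto
  moreover note nth_measurable[OF assms, measurable]
  have "{\<beta> \<in> space (Rd d). \<beta> k \<noteq> 0} \<in> sets (Rd d)" by measurable
  ultimately show ?thesis
    unfolding sphere_measure_def
    by (subst AE_distr_iff) (auto simp: measurable_cong_sets[OF sets_uniform_measure refl])
qed

section \<open>The perturbed uniform laws on the line\<close>

definition unif :: "real measure" where
  "unif = uniform_measure lborel {0..1}"

text \<open>Half-lines serve as the outer thirds because \<open>unif\<close> lives on the unit
  interval. Being affine in \<delta>, the family is closed under mixtures.\<close>

definition tilt :: "real \<Rightarrow> real \<Rightarrow> real" where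
  "tilt \<delta> u = 1 + \<delta> * (indicator {..<1/3} u - indicator {2/3<..} u)"

definition tilted :: "real \<Rightarrow> real measure" where
  "tilted \<delta> = density unif (tilt \<delta>)"

text \<open>The restriction to \<open>{..<d}\<close> is there because points of \<open>Rd d\<close>
  are extensional functions.\<close>

definition first_axis :: "nat \<Rightarrow> real \<Rightarrow> nat \<Rightarrow> real" where
  "first_axis d u = (\<lambda>i\<in>{..<d}. if i = 0 then u else 0)"

definition tilted_law :: "nat \<Rightarrow> real \<Rightarrow> (nat \<Rightarrow> real) measure" where
  "tilted_law d \<delta> = distr (tilted \<delta>) (Rd d) (first_axis d)"

lemma sets_unif [simp, measurable_cong]: "sets unif = sets borel"
  by (simp add: unif_def)

lemma space_unif [simp]: "space unif = UNIV"
  by (simp add: unif_def)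

lemma sets_tilted [simp, measurable_cong]: "sets (tilted \<delta>) = sets borel"
  by (simp add: tilted_def)

lemma space_tilted [simp]: "space (tilted \<delta>) = UNIV"
  by (simp add: tilted_def)

lemma prob_space_unif: "prob_space unif"
  unfolding unif_def by (rule prob_space_uniform_measure) auto

interpretation unif: prob_space unif
  by (rule prob_space_unif)

lemma measure_unif: "A \<in> sets borel \<Longrightarrow> measure unif A = measure lborel ({0..1} \<inter> A)"
  unfolding unif_def by (subst measure_uniform_measure) auto

lemma measure_unif_third:
  "measure unif {..<1/3} = 1/3" "measure unif {2/3<..} = 1/3" "measure unif {1/3..2/3} = 1/3"
proof -
  have "{0..1} \<inter> {..<1/3} = {0..<1/3::real}" "{0..1} \<inter> {2/3<..} = {2/3<..1::real}"
    "{0..1} \<inter> {1/3..2/3} = {1/3..2/3::real}"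
    by auto
  then show "measure unif {..<1/3} = 1/3" "measure unif {2/3<..} = 1/3"
      "measure unif {1/3..2/3} = 1/3"
    by (simp_all add: measure_unif)
qed

lemma measure_unif_singleton: "measure unif {x} = 0"
proof -
  have "{0..1} \<inter> {x} = (if x \<in> {0..1} then {x} else {})" by auto
  then show ?thesis by (simp add: measure_unif)
qed

lemma tilt_measurable [measurable]: "tilt \<delta> \<in> borel_measurable borel"
  unfolding tilt_def by measurable

lemma tilt_0 [simp]: "tilt 0 u = 1"
  by (simp add: tilt_def)

lemma tilted_0: "tilted 0 = unif"
  by (simp add: tilted_def density_1)

context
  fixes \<delta> :: real
  assumes \<delta>: "0 \<le> \<delta>" "\<delta> \<le> 1"
begin

lemma tilt_nonneg: "0 \<le> tilt \<delta> u"
  using \<delta> by (auto simp: tilt_def split: split_indicator)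

lemma tilt_bounded: "\<bar>tilt \<delta> u\<bar> \<le> 2"
  using \<delta> by (auto simp: tilt_def split: split_indicator)

text \<open>Total mass, absence of atoms, mixtures and differences of the perturbed laws are all
  read off from this formula, affine in \<delta>.\<close>

lemma measure_tilted:
  assumes [measurable]: "E \<in> sets borel"
  shows "measure (tilted \<delta>) E =
    measure unif E + \<delta> * (measure unif (E \<inter> {..<1/3}) - measure unif (E \<inter> {2/3<..}))"
proof -
  have i: "integrable unif (\<lambda>u. tilt \<delta> u * indicator E u)"
    by (rule unif.integrable_const_bound[of _ 2])
      (use tilt_bounded in \<open>auto split: split_indicator\<close>)
  have ind: "integrable unif (indicator A :: real \<Rightarrow> real)" if "A \<in> sets borel" for A
    using that by (auto simp: unif.emeasure_eq_measure intro!: integrable_real_indicator)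
  have "emeasure (tilted \<delta>) E = (\<integral>\<^sup>+u. ennreal (tilt \<delta> u * indicator E u) \<partial>unif)"
    unfolding tilted_def
    by (subst emeasure_density) (auto intro!: nn_integral_cong split: split_indicator)
  also have "\<dots> = ennreal (\<integral>u. tilt \<delta> u * indicator E u \<partial>unif)"
    using tilt_nonneg by (intro nn_integral_eq_integral i) auto
  finally have "measure (tilted \<delta>) E = (\<integral>u. tilt \<delta> u * indicator E u \<partial>unif)"
    unfolding measure_def using tilt_nonneg by (simp add: integral_nonneg)
  also have "\<dots> = (\<integral>u. indicator E u + \<delta> * (indicator (E \<inter> {..<1/3}) u - indicator (E \<inter> {2/3<..}) u) \<partial>unif)"
    by (intro Bochner_Integration.integral_cong) (auto simp: tilt_def split: split_indicator)
  also have "\<dots> = measure unif E + \<delta> * (measure unif (E \<inter> {..<1/3}) - measure unif (E \<inter> {2/3<..}))"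
    using ind by simp
  finally show ?thesis .
qed

lemma prob_space_tilted: "prob_space (tilted \<delta>)"
proof (rule prob_spaceI)
  have "measure (tilted \<delta>) UNIV = 1"
    using unif.prob_space by (simp add: measure_tilted measure_unif_third)
  \<comment> \<open>\<open>measure\<close> sends infinite mass to 0, so the value 1 also yields
    finiteness.\<close>
  moreover from this have "emeasure (tilted \<delta>) UNIV \<noteq> top"
    by (auto simp: measure_def)
  ultimately show "emeasure (tilted \<delta>) (space (tilted \<delta>)) = 1"
    by (simp add: emeasure_eq_ennreal_measure)
qed

text \<open>The terms linear in \<delta> cancel between the outer thirds; the exact value is 1 + 2
  \<delta>^2 / 3.\<close>

lemma integral_tilt_square: "(\<integral>u. (tilt \<delta> u)\<^sup>2 \<partial>unif) \<le> 1 + \<delta>\<^sup>2"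
proof -
  have ind: "integrable unif (indicator A :: real \<Rightarrow> real)" if "A \<in> sets borel" for A
    using that by (auto simp: unif.emeasure_eq_measure intro!: integrable_real_indicator)
  have "(\<integral>u. (tilt \<delta> u)\<^sup>2 \<partial>unif) =
      (\<integral>u. 1 + (2 * \<delta> + \<delta>\<^sup>2) * indicator {..<1/3} u + (\<delta>\<^sup>2 - 2 * \<delta>) * indicator {2/3<..} u \<partial>unif)"
    by (intro Bochner_Integration.integral_cong)
      (auto simp: tilt_def power2_eq_square algebra_simps split: split_indicator)
  also have "\<dots> = 1 + (2 * \<delta> + \<delta>\<^sup>2) * (1/3) + (\<delta>\<^sup>2 - 2 * \<delta>) * (1/3)"
    using ind unif.prob_space by (simp add: measure_unif_third)
  also have "\<dots> \<le> 1 + \<delta>\<^sup>2" by (simp add: field_simps)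
  finally show ?thesis .
qed

lemma measure_tilted_singleton: "measure (tilted \<delta>) {x} = 0"
proof -
  have "measure unif ({x} \<inter> A) = 0" if "A \<in> sets borel" for A
    using unif.finite_measure_mono[of "{x} \<inter> A" "{x}"] measure_unif_singleton[of x] that
    by (simp add: measure_le_0_iff)
  then show ?thesis by (simp add: measure_tilted measure_unif_singleton)
qed

end

section \<open>Embedding the line into the first axis\<close>

lemma first_axis_measurable [measurable]: "first_axis d \<in> measurable borel (Rd d)"
  unfolding first_axis_def Rd_def by measurable

lemma ip_measurable [measurable]: "ip d \<beta> \<in> borel_measurable (Rd d)"
  unfolding ip_def Rd_def by measurable

lemma ip_first_axis: "0 < d \<Longrightarrow> ip d \<beta> (first_axis d u) = \<beta> 0 * u"
  by (simp add: ip_def first_axis_def if_distrib[of "(*) _"] cong: if_cong)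

text \<open>On the first axis the inner product with \<beta> is multiplication by
  \<open>\<beta> 0\<close>, so all projections are rescalings of one law and the dimension drops
  out.\<close>

lemma distr_tilted_law:
  assumes "0 < d"
  shows "distr (tilted_law d \<delta>) borel (ip d \<beta>) = distr (tilted \<delta>) borel ((*) (\<beta> 0))"
  unfolding tilted_law_def
  by (subst distr_distr) (auto simp: o_def ip_first_axis assms)

lemma proj_cdf_tilted_law:
  assumes "0 < d"
  shows "proj_cdf d (tilted_law d \<delta>) \<beta> t = measure (tilted \<delta>) {v. \<beta> 0 * v \<le> t}"
  unfolding proj_cdf_def distr_tilted_law[OF assms] cdf_def
  by (subst measure_distr) (auto simp: vimage_def)

lemma tilted_law_in_prob_measures:
  assumes "0 \<le> \<delta>" "\<delta> \<le> 1"
  shows "tilted_law d \<delta> \<in> prob_measures d"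
proof -
  interpret prob_space "tilted \<delta>" by (rule prob_space_tilted[OF assms])
  show ?thesis
    unfolding prob_measures_def tilted_law_def by (auto intro!: prob_space_distr)
qed

text \<open>When \<open>\<beta> 0\<close> is nonzero, the preimage of a point under the scaling is a
  point, and the law on the line has no atoms.\<close>

lemma cont_projections_tilted_law:
  assumes "0 \<le> \<delta>" "\<delta> \<le> 1" "0 < d"
  shows "cont_projections d (tilted_law d \<delta>)"
  unfolding cont_projections_def
  using AE_sphere_measure_nth_ne_0[OF \<open>0 < d\<close>]
proof (rule AE_mp, intro AE_I2 impI)
  fix \<beta> :: "nat \<Rightarrow> real" assume \<beta>: "\<beta> 0 \<noteq> 0"
  interpret prob_space "tilted \<delta>" by (rule prob_space_tilted) fact+
  interpret D: real_distribution "distr (tilted \<delta>) borel ((*) (\<beta> 0))"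
    by (rule real_distribution_distr) simp
  have "measure (distr (tilted \<delta>) borel ((*) (\<beta> 0))) {x} = 0" for x
  proof -
    have "(*) (\<beta> 0) -` {x} = {x / \<beta> 0}" using \<beta> by (auto simp: field_simps)
    then show ?thesis
      using measure_tilted_singleton assms by (simp add: measure_distr)
  qed
  then show "continuous_on UNIV (proj_cdf d (tilted_law d \<delta>) \<beta>)"
    unfolding proj_cdf_def distr_tilted_law[OF \<open>0 < d\<close>]
    by (intro continuous_at_imp_continuous_on) (simp add: D.isCont_cdf)
qed

text \<open>The first coordinate inverts the embedding, so the density on the line carries over as a
  function of that coordinate. This is the form in which the chi-square bound applies.\<close>

lemma tilted_law_density:
  assumes "0 < d"
  shows "tilted_law d \<delta> = density (tilted_law d 0) (\<lambda>x. tilt \<delta> (x 0))"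
proof -
  note nth_measurable[OF assms, measurable]
  have "density (tilted_law d 0) (\<lambda>x. tilt \<delta> (x 0)) = distr (density unif (\<lambda>u. tilt \<delta> (first_axis d u 0))) (Rd d) (first_axis d)"
    unfolding tilted_law_def tilted_0 by (rule density_distr) (auto simp: measurable_cong_sets[OF sets_unif refl])
  also have "\<dots> = tilted_law d \<delta>"
    using assms by (simp add: tilted_law_def tilted_def first_axis_def)
  finally show ?thesis ..
qed

section \<open>Lower bound for the CvM-distance\<close>

text \<open>Masses under \<open>tilted\<close> are affine in the parameter, so the mixture of the
  two distribution functions belongs to the averaged parameter.\<close>

lemma interval_measure_mix:
  assumes a: "0 \<le> a" "a \<le> 1" and b: "0 \<le> b" "b \<le> 1" and \<theta>: "0 < \<theta>" "\<theta> < 1" and d: "0 < d"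
  shows "interval_measure (\<lambda>t. \<theta> * proj_cdf d (tilted_law d a) \<beta> t + (1 - \<theta>) * proj_cdf d (tilted_law d b) \<beta> t) =
    distr (tilted (\<theta> * a + (1 - \<theta>) * b)) borel ((*) (\<beta> 0))"
proof -
  let ?c = "\<theta> * a + (1 - \<theta>) * b"
  have c: "0 \<le> ?c" "?c \<le> 1"
    using assms convex_bound_le[of a 1 b \<theta> "1 - \<theta>"] by auto
  interpret prob_space "tilted ?c" by (rule prob_space_tilted[OF c])
  have "\<theta> * proj_cdf d (tilted_law d a) \<beta> t + (1 - \<theta>) * proj_cdf d (tilted_law d b) \<beta> t = proj_cdf d (tilted_law d ?c) \<beta> t" for t
    using a b c by (simp add: proj_cdf_tilted_law[OF d] measure_tilted algebra_simps)
  then have "(\<lambda>t. \<theta> * proj_cdf d (tilted_law d a) \<beta> t + (1 - \<theta>) * proj_cdf d (tilted_law d b) \<beta> t) =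
      cdf (distr (tilted ?c) borel ((*) (\<beta> 0)))"
    by (simp add: fun_eq_iff proj_cdf_def distr_tilted_law[OF d])
  then show ?thesis
    by (simp add: interval_measure_cdf)
qed

text \<open>Evaluating at \<open>t = \<beta> 0 * u\<close> removes the scale, so the inner integral depends on \<open>\<beta>\<close> only
  through the sign of \<open>\<beta> 0\<close>; in particular it is measurable in \<open>\<beta>\<close>.\<close>

lemma CvM_sq_tilted_law_ge:
  assumes a: "0 \<le> a" "a \<le> 1" and b: "0 \<le> b" "b \<le> 1" and \<theta>: "0 < \<theta>" "\<theta> < 1" and d: "0 < d"
  shows "(a - b)\<^sup>2 / 27 \<le> CvM_sq d \<theta> (tilted_law d a) (tilted_law d b)"
proof -
  define T where "T = tilted (\<theta> * a + (1 - \<theta>) * b)"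
  have c: "0 \<le> \<theta> * a + (1 - \<theta>) * b" "\<theta> * a + (1 - \<theta>) * b \<le> 1"
    using assms convex_bound_le[of a 1 b \<theta> "1 - \<theta>"] by auto
  interpret T: prob_space T
    unfolding T_def by (rule prob_space_tilted[OF c])
  have sT [measurable_cong]: "sets T = sets borel" by (simp add: T_def)
  define h where "h E = (measure (tilted a) E - measure (tilted b) E)\<^sup>2" for E
  define I where "I s = (LINT u|T. h {v. s * v \<le> s * u})" for s :: real
  \<comment> \<open>The value at 0 concerns only a null set of directions; keeping it makes the
    identity with \<open>I\<close> hold without exception.\<close>
  define J where "J s = (if 0 < s then I 1 else if s < 0 then I (-1) else I 0)" for s :: real
  have IJ: "I s = J s" for s
  proof -
    have "{v. s * v \<le> s * u} = {v. 1 * v \<le> 1 * u}" if "0 < s" for u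
      using that by simp
    moreover have "{v. s * v \<le> s * u} = {v. -1 * v \<le> -1 * u}" if "s < 0" for u
      using that by simp
    ultimately show ?thesis
      unfolding I_def J_def by (cases "s = 0") (auto simp: not_less)
  qed
  interpret A: prob_space "tilted a" by (rule prob_space_tilted) fact+
  interpret B: prob_space "tilted b" by (rule prob_space_tilted) fact+
  have cdfm: "proj_cdf d (tilted_law d e) \<beta> \<in> borel_measurable borel" if "0 \<le> e" "e \<le> 1" for e \<beta>
  proof -
    interpret E: prob_space "tilted e" by (rule prob_space_tilted[OF that])
    interpret D: real_distribution "distr (tilted e) borel ((*) (\<beta> 0))"
      by (rule E.real_distribution_distr) simp
    show ?thesis
      unfolding proj_cdf_def distr_tilted_law[OF d]
      by (intro borel_measurable_mono monoI D.cdf_nondecreasing)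
  qed
  have inner: "(LINT t|interval_measure (\<lambda>t. \<theta> * proj_cdf d (tilted_law d a) \<beta> t + (1 - \<theta>) * proj_cdf d (tilted_law d b) \<beta> t).
      (proj_cdf d (tilted_law d a) \<beta> t - proj_cdf d (tilted_law d b) \<beta> t)\<^sup>2) = J (\<beta> 0)" for \<beta>
  proof -
    note cdfm[OF a, measurable] cdfm[OF b, measurable]
    show ?thesis
      unfolding interval_measure_mix[OF assms] IJ[symmetric]
      by (subst integral_distr) (auto simp: I_def h_def T_def proj_cdf_tilted_law[OF d])
  qed
  have hm: "(\<lambda>u. h {v. s * v \<le> s * u}) \<in> borel_measurable borel" for s
  proof -
    \<comment> \<open>The mass of the half-line is a monotone distribution function, in the constant
      direction \<open>s\<close>, composed with a scaling.\<close>
    have "(\<lambda>u. proj_cdf d (tilted_law d e) (\<lambda>_. s) (s * u)) \<in> borel_measurable borel" if "0 \<le> e" "e \<le> 1" for e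
      by (intro measurable_compose[OF _ cdfm[OF that]]) auto
    from this[OF a] this[OF b] show ?thesis
      unfolding h_def proj_cdf_tilted_law[OF d] by measurable
  qed
  have lower: "(a - b)\<^sup>2 / 27 \<le> I s" if s: "s = 1 \<or> s = -1" for s
  proof -
    \<comment> \<open>From a point of the middle third, the half-line contains one outer third
      completely and misses the other; the sign of \<open>s\<close> decides which.\<close>
    have hmid: "h {v. s * v \<le> s * u} = (a - b)\<^sup>2 / 9" if u: "u \<in> {1/3..2/3}" for u
    proof -
      let ?E = "{v. s * v \<le> s * u}"
      have "measure unif (?E \<inter> {..<1/3}) - measure unif (?E \<inter> {2/3<..}) = s / 3"
        using s
      proof
        assume "s = 1"
        then have "?E \<inter> {..<1/3} = {..<1/3}" "?E \<inter> {2/3<..} = {}" using u by auto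
        then show ?thesis using \<open>s = 1\<close> by (simp add: measure_unif_third)
      next
        assume "s = -1"
        then have "?E \<inter> {..<1/3} = {}" "?E \<inter> {2/3<..} = {2/3<..}" using u by auto
        then show ?thesis using \<open>s = -1\<close> by (simp add: measure_unif_third)
      qed
      moreover have "h ?E =
          ((a - b) * (measure unif (?E \<inter> {..<1/3}) - measure unif (?E \<inter> {2/3<..})))\<^sup>2"
        using a b by (simp add: h_def measure_tilted algebra_simps)
      ultimately have "h ?E = ((a - b) * (s / 3))\<^sup>2" by (simp only:)
      also have "\<dots> = (a - b)\<^sup>2 / 9"
        using s by (auto simp: power_mult_distrib power_divide)
      finally show ?thesis .
    qed
    have h1: "\<bar>h E\<bar> \<le> 1" for E
    proof -
      have "\<bar>measure (tilted a) E - measure (tilted b) E\<bar> \<le> 1"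
        using A.prob_le_1[of E] B.prob_le_1[of E] measure_nonneg[of "tilted a" E] measure_nonneg[of "tilted b" E]
        by linarith
      then show ?thesis by (simp add: h_def abs_square_le_1)
    qed
    \<comment> \<open>The middle third is never reweighted, so this mass is the same for all
      \<theta>; together with 1/9 it gives the constant 27.\<close>
    have "measure T {1/3..2/3} = 1/3"
    proof -
      have "{1/3..2/3} \<inter> {..<1/3} = ({}::real set)" "{1/3..2/3} \<inter> {2/3<..} = ({}::real set)"
        by auto
      then show ?thesis
        by (simp add: T_def measure_tilted[OF c] measure_unif_third)
    qed
    then have "(a - b)\<^sup>2 / 27 = (LINT u|T. (a - b)\<^sup>2 / 9 * indicator {1/3..2/3} u)"
      by (simp add: T_def)
    also have "\<dots> \<le> I s"
      unfolding I_def
    proof (rule integral_mono)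
      show "integrable T (\<lambda>u. (a - b)\<^sup>2 / 9 * indicator {1/3..2/3} u)"
        by (rule T.integrable_const_bound[of _ "(a - b)\<^sup>2 / 9"]) (auto split: split_indicator)
      show "integrable T (\<lambda>u. h {v. s * v \<le> s * u})"
        by (rule T.integrable_const_bound[of _ 1]) (use h1 hm in auto)
      show "(a - b)\<^sup>2 / 9 * indicator {1/3..2/3} u \<le> h {v. s * v \<le> s * u}" for u
        using hmid[of u] by (auto simp: h_def split: split_indicator)
    qed
    finally show ?thesis .
  qed
  interpret S: prob_space "sphere_measure d"
    using d by (intro prob_space_sphere_measure) simp
  have [measurable]: "(\<lambda>\<beta>. \<beta> 0) \<in> borel_measurable (sphere_measure d)"
    using nth_measurable[OF d] by (simp add: sphere_measure_def)
  have "AE \<beta> in sphere_measure d. (a - b)\<^sup>2 / 27 \<le> J (\<beta> 0)"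
    using AE_sphere_measure_nth_ne_0[OF d]
    by (rule AE_mp) (use lower in \<open>auto simp: J_def\<close>)
  moreover have "integrable (sphere_measure d) (\<lambda>\<beta>. J (\<beta> 0))"
    by (rule S.integrable_const_bound[of _ "max \<bar>I 1\<bar> (max \<bar>I (-1)\<bar> \<bar>I 0\<bar>)"])
      (auto simp: J_def)
  ultimately show ?thesis
    unfolding CvM_sq_def inner by (intro S.integral_ge_const)
qed

lemma tilted_law_in_alternatives:
  assumes "0 \<le> a" "a \<le> 1" "0 \<le> b" "b \<le> 1" "0 < \<theta>" "\<theta> < 1" "0 < d"
    and \<epsilon>: "\<epsilon>\<^sup>2 \<le> (a - b)\<^sup>2 / 27"
  shows "(tilted_law d a, tilted_law d b) \<in> alternatives d \<theta> \<epsilon>"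
proof -
  have "\<epsilon>\<^sup>2 \<le> CvM_sq d \<theta> (tilted_law d a) (tilted_law d b)"
    using CvM_sq_tilted_law_ge[of a b \<theta> d] assms by linarith
  then have "\<epsilon> \<le> CvM_dist d \<theta> (tilted_law d a) (tilted_law d b)"
    unfolding CvM_dist_def by (rule real_le_rsqrt)
  then show ?thesis
    unfolding alternatives_def using assms tilted_law_in_prob_measures cont_projections_tilted_law by simp
qed

section \<open>Closeness of the sample laws\<close>

text \<open>The second moment of the one-observation likelihood ratio is an integral over the line,
  so the bound is free of \<open>d\<close>.\<close>

lemma measure_PiM_tilted_law_le:
  assumes \<delta>: "0 \<le> \<delta>" "\<delta> \<le> 1" and d: "0 < d"
    and B: "B \<in> sets (PiM {..<k} (\<lambda>_. tilted_law d 0))"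
  shows "measure (PiM {..<k} (\<lambda>_. tilted_law d \<delta>)) B \<le>
    measure (PiM {..<k} (\<lambda>_. tilted_law d 0)) B + sqrt ((1 + \<delta>\<^sup>2) ^ k - 1)"
proof -
  interpret P: prob_space "tilted_law d 0"
    using tilted_law_in_prob_measures[of 0 d] by (simp add: prob_measures_def)
  have Q: "prob_space (density (tilted_law d 0) (\<lambda>x. tilt \<delta> (x 0)))"
    using tilted_law_in_prob_measures[OF \<delta>, of d] tilted_law_density[OF d, of \<delta>] by (simp add: prob_measures_def)
  note nth_measurable[OF d, measurable]
  have m: "(\<lambda>x. tilt \<delta> (x 0)) \<in> borel_measurable (tilted_law d 0)"
    unfolding tilted_law_def by measurable
  have int: "integrable (tilted_law d 0) (\<lambda>x. (tilt \<delta> (x 0))\<^sup>2)"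
  proof (rule P.integrable_const_bound[of _ "2\<^sup>2"])
    have "(tilt \<delta> u)\<^sup>2 \<le> 2\<^sup>2" for u
      using tilt_bounded[OF \<delta>, of u] by (intro power2_le_iff_abs_le[THEN iffD2]) auto
    then show "AE x in tilted_law d 0. norm ((tilt \<delta> (x 0))\<^sup>2) \<le> 2\<^sup>2" by simp
  qed (use m in simp)
  have "P.expectation (\<lambda>x. (tilt \<delta> (x 0))\<^sup>2) = (\<integral>u. (tilt \<delta> u)\<^sup>2 \<partial>unif)"
    unfolding tilted_law_def tilted_0 using d
    by (subst integral_distr) (auto simp: first_axis_def measurable_cong_sets[OF sets_unif refl] first_axis_measurable[unfolded first_axis_def])
  then have s: "P.expectation (\<lambda>x. (tilt \<delta> (x 0))\<^sup>2) \<le> 1 + \<delta>\<^sup>2"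
    using integral_tilt_square[OF \<delta>] by simp
  show ?thesis
    using P.measure_PiM_density_le[OF m tilt_nonneg[OF \<delta>] Q int s _ B]
    by (simp flip: tilted_law_density[OF d])
qed

text \<open>Perturbing only one of the two samples costs a power given by the size of that sample
  alone.\<close>

lemma measure_sample_law_le:
  assumes \<delta>: "0 \<le> \<delta>" "\<delta> \<le> 1" and d: "0 < d"
    and A: "A \<in> sets (sample_law m n (tilted_law d 0) (tilted_law d 0))"
  shows "measure (sample_law m n (tilted_law d 0) (tilted_law d \<delta>)) A \<le>
      measure (sample_law m n (tilted_law d 0) (tilted_law d 0)) A + sqrt ((1 + \<delta>\<^sup>2) ^ n - 1)"
    and "measure (sample_law m n (tilted_law d \<delta>) (tilted_law d 0)) A \<le>
      measure (sample_law m n (tilted_law d 0) (tilted_law d 0)) A + sqrt ((1 + \<delta>\<^sup>2) ^ m - 1)"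
proof -
  have p: "prob_space (PiM {..<k} (\<lambda>_. tilted_law d e))" if "0 \<le> e" "e \<le> 1" for k e
    using tilted_law_in_prob_measures[OF that] by (intro prob_space_PiM) (simp add: prob_measures_def)
  have p0: "prob_space (PiM {..<k} (\<lambda>_. tilted_law d 0))" for k by (rule p) auto
  have s: "sets (PiM {..<k} (\<lambda>_. tilted_law d \<delta>)) = sets (PiM {..<k} (\<lambda>_. tilted_law d 0))" for k
    by (intro sets_PiM_cong) (auto simp: tilted_law_def)
  show "measure (sample_law m n (tilted_law d 0) (tilted_law d \<delta>)) A \<le>
      measure (sample_law m n (tilted_law d 0) (tilted_law d 0)) A + sqrt ((1 + \<delta>\<^sup>2) ^ n - 1)"
    using A unfolding sample_law_def
    by (intro measure_pair_le_snd p0 p \<delta> s measure_PiM_tilted_law_le d) auto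
  show "measure (sample_law m n (tilted_law d \<delta>) (tilted_law d 0)) A \<le>
      measure (sample_law m n (tilted_law d 0) (tilted_law d 0)) A + sqrt ((1 + \<delta>\<^sup>2) ^ m - 1)"
    using A unfolding sample_law_def
    by (intro measure_pair_le_fst p0 p \<delta> s measure_PiM_tilted_law_le d) auto
qed

section \<open>The two-point argument and the choice of constants\<close>

text \<open>For every level-\<alpha> test one fixed alternative bounds the supremum from below: its
  rejection probability exceeds that under the null by at most 1 - \<alpha> - \<zeta>. The last two
  hypotheses ask for \<delta> large enough to separate and small enough to stay undetected.\<close>

lemma minimax_type2_error_ge:
  assumes \<delta>: "0 \<le> \<delta>" "\<delta> \<le> 1" and d: "0 < d" and \<theta>: "0 < \<theta>" "\<theta> < 1"
    and \<epsilon>: "\<epsilon>\<^sup>2 \<le> \<delta>\<^sup>2 / 27" and \<kappa>: "sqrt ((1 + \<delta>\<^sup>2) ^ min m n - 1) \<le> 1 - \<alpha> - \<zeta>"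
  shows "ennreal \<zeta> \<le> minimax_type2_error d \<theta> m n \<alpha> \<epsilon>"
  unfolding minimax_type2_error_def
proof (rule INF_greatest)
  fix \<phi> assume \<phi>: "\<phi> \<in> level_tests d m n \<alpha>"
  \<comment> \<open>Perturbing the smaller sample makes the exponent \<open>min m n\<close>.\<close>
  define P Q where "P = (if n \<le> m then tilted_law d 0 else tilted_law d \<delta>)"
    and "Q = (if n \<le> m then tilted_law d \<delta> else tilted_law d 0)"
  have alt: "(P, Q) \<in> alternatives d \<theta> \<epsilon>"
    unfolding P_def Q_def using assms by (auto intro!: tilted_law_in_alternatives)
  let ?N = "sample_law m n (tilted_law d 0) (tilted_law d 0)"
  let ?S = "sample_law m n P Q"
  have sets_law: "sets P = sets (Rd d)" "sets Q = sets (Rd d)" "sets (tilted_law d 0) = sets (Rd d)"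
    by (auto simp: P_def Q_def tilted_law_def)
  have prob: "prob_space P" "prob_space Q"
    using alt by (auto simp: alternatives_def prob_measures_def)
  have sS: "sets (sample_law m n R R') = sets (PiM {..<m} (\<lambda>_. Rd d) \<Otimes>\<^sub>M PiM {..<n} (\<lambda>_. Rd d))"
    if "sets R = sets (Rd d)" "sets R' = sets (Rd d)" for R R'
    unfolding sample_law_def using that by (intro sets_pair_measure_cong sets_PiM_cong) auto
  have sets: "sets ?S = sets (PiM {..<m} (\<lambda>_. Rd d) \<Otimes>\<^sub>M PiM {..<n} (\<lambda>_. Rd d))"
      "sets ?N = sets (PiM {..<m} (\<lambda>_. Rd d) \<Otimes>\<^sub>M PiM {..<n} (\<lambda>_. Rd d))"
    using sets_law by (simp_all add: sS)
  interpret S: prob_space ?S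
  proof -
    interpret p1: prob_space "PiM {..<m} (\<lambda>_. P)" by (intro prob_space_PiM prob)
    interpret p2: prob_space "PiM {..<n} (\<lambda>_. Q)" by (intro prob_space_PiM prob)
    interpret pair_prob_space "PiM {..<m} (\<lambda>_. P)" "PiM {..<n} (\<lambda>_. Q)" ..
    show "prob_space ?S" unfolding sample_law_def by unfold_locales
  qed
  have space: "space ?N = space ?S"
    using sets by (intro sets_eq_imp_space_eq) simp
  have \<phi>m: "\<phi> \<in> measurable ?S (count_space {0, 1})"
    using \<phi> by (simp add: level_tests_def measurable_cong_sets[OF sets(1) refl])
  define R0 R1 where "R0 = {\<omega> \<in> space ?S. \<phi> \<omega> = 0}" and "R1 = {\<omega> \<in> space ?S. \<phi> \<omega> = 1}"
  have R: "R0 \<in> sets ?S" "R1 \<in> sets ?S"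
    using measurable_sets[OF \<phi>m, of "{0}"] measurable_sets[OF \<phi>m, of "{1}"]
    by (auto simp: R0_def R1_def vimage_def Int_def conj_commute)
  have "R0 = space ?S - R1"
    using measurable_space[OF \<phi>m] by (auto simp: R0_def R1_def)
  then have R0: "measure ?S R0 = 1 - measure ?S R1"
    using R by (simp add: S.prob_compl)
  have "measure ?N R1 \<le> \<alpha>"
    using \<phi> tilted_law_in_prob_measures[of 0 d] cont_projections_tilted_law[of 0 d] d
    unfolding R1_def space[symmetric] by (simp add: level_tests_def)
  moreover have "measure ?S R1 \<le> measure ?N R1 + (1 - \<alpha> - \<zeta>)"
  proof -
    have "R1 \<in> sets ?N" using R sets by simp
    then show ?thesis
      using measure_sample_law_le[OF \<delta> d, of R1 m n] \<kappa>
      by (auto simp: P_def Q_def min_def split: if_splits)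
  qed
  ultimately have "\<zeta> \<le> measure ?S R0" using R0 by simp
  then have "ennreal \<zeta> \<le> emeasure ?S R0"
    by (simp add: S.emeasure_eq_measure)
  also have "\<dots> \<le> (SUP (P, Q) \<in> alternatives d \<theta> \<epsilon>.
      emeasure (sample_law m n P Q) {\<omega> \<in> space (sample_law m n P Q). \<phi> \<omega> = 0})"
    unfolding R0_def by (rule SUP_upper2[OF alt]) simp
  finally show "ennreal \<zeta> \<le> \<dots>" .
qed

theorem theorem4p1:
  fixes \<alpha> \<zeta> :: real
  assumes "0 < \<alpha>" "\<alpha> < 1" "0 < \<zeta>" "\<zeta> < 1 - \<alpha>"
  shows "\<exists>b::real. b > 0 \<and>
    (\<forall>d m n :: nat. \<forall>\<theta>::real. d \<ge> 1 \<longrightarrow> m \<ge> 2 \<longrightarrow> n \<ge> 2 \<longrightarrow> 0 < \<theta> \<longrightarrow> \<theta> < 1 \<longrightarrow>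
      minimax_type2_error d \<theta> m n \<alpha> (b * (1 / sqrt (real m) + 1 / sqrt (real n))) \<ge> ennreal \<zeta>)"
proof -
  define \<kappa> where "\<kappa> = 1 - \<alpha> - \<zeta>"
  have \<kappa>: "0 < \<kappa>" using assms by (simp add: \<kappa>_def)
  \<comment> \<open>Chosen so that (1 + c/k)^k \<le> exp c \<le> 1 + \<kappa>^2; the cap at 1 keeps
    \<delta> in the unit interval.\<close>
  define c where "c = min 1 (ln (1 + \<kappa>\<^sup>2))"
  have c: "0 < c" "c \<le> 1" "exp c \<le> 1 + \<kappa>\<^sup>2"
  proof -
    have "0 < \<kappa>\<^sup>2" using \<kappa> by simp
    then have "0 < ln (1 + \<kappa>\<^sup>2)" and *: "exp (ln (1 + \<kappa>\<^sup>2)) = 1 + \<kappa>\<^sup>2"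
      by (auto intro: add_pos_pos ln_gt_zero)
    then show "0 < c" "c \<le> 1" by (auto simp: c_def)
    have "exp c \<le> exp (ln (1 + \<kappa>\<^sup>2))" by (simp only: exp_le_cancel_iff) (simp add: c_def)
    then show "exp c \<le> 1 + \<kappa>\<^sup>2" by (simp only: *)
  qed
  \<comment> \<open>The 27 comes from the distance bound. The 2 compensates for the sum of two
    inverse roots, which is at most 2 / sqrt k with k the smaller sample size.\<close>
  define b where "b = sqrt (c / 27) / 2"
  have "ennreal \<zeta> \<le> minimax_type2_error d \<theta> m n \<alpha> (b * (1 / sqrt (real m) + 1 / sqrt (real n)))"
    if d: "d \<ge> 1" and m: "m \<ge> 2" and n: "n \<ge> 2" and \<theta>: "0 < \<theta>" "\<theta> < 1" for d m n :: nat and \<theta> :: real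
  proof -
    define k where "k = min m n"
    have k: "2 \<le> k" "k \<le> m" "k \<le> n" using m n by (auto simp: k_def)
    define \<delta> where "\<delta> = sqrt (c / real k)"
    have \<delta>2: "\<delta>\<^sup>2 = c / real k" using c by (simp add: \<delta>_def)
    have \<delta>: "0 \<le> \<delta>" "\<delta> \<le> 1"
      using c k by (auto simp: \<delta>_def divide_le_eq)
    show ?thesis
    proof (rule minimax_type2_error_ge[OF \<delta> _ \<theta>])
      show "0 < d" using d by simp
      have "1 / sqrt (real m) + 1 / sqrt (real n) \<le> 1 / sqrt (real k) + 1 / sqrt (real k)"
        using k by (intro add_mono divide_left_mono) auto
      then have "(b * (1 / sqrt (real m) + 1 / sqrt (real n)))\<^sup>2 \<le> (b * (2 / sqrt (real k)))\<^sup>2"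
        using c by (intro power_mono mult_left_mono) (auto simp: b_def)
      also have "\<dots> = \<delta>\<^sup>2 / 27"
        using c by (simp add: \<delta>2 b_def power_mult_distrib power_divide)
      finally show "(b * (1 / sqrt (real m) + 1 / sqrt (real n)))\<^sup>2 \<le> \<delta>\<^sup>2 / 27" .
      have "(1 + \<delta>\<^sup>2) ^ k \<le> exp (\<delta>\<^sup>2) ^ k"
        by (intro power_mono exp_ge_add_one_self) simp
      also have "\<dots> = exp c"
        using k by (simp add: \<delta>2 flip: exp_of_nat_mult)
      also have "\<dots> \<le> 1 + \<kappa>\<^sup>2" by (rule c)
      finally have "(1 + \<delta>\<^sup>2) ^ k - 1 \<le> \<kappa>\<^sup>2" by simp
      then show "sqrt ((1 + \<delta>\<^sup>2) ^ min m n - 1) \<le> 1 - \<alpha> - \<zeta>"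
        using \<kappa> by (intro real_le_lsqrt) (auto simp: k_def \<kappa>_def)
    qed
  qed
  moreover have "b > 0" using c by (simp add: b_def)
  ultimately show ?thesis by blast
qed

end
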